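(* Consider the restless bandit problem with switching costs with $N$ sites and $M\le N$ active agents, and let $(\bar\lambda,\bar\mu,\bar\kappa,\bar\zeta,\bar\xi)$ be an optimal solution of the dual linear program (D) defined in the context. Let $I((\mathbf x;\mathbf s),\mathbf a)$ be the associated index of undesirability, $\tilde J(\mathbf x;\mathbf s)=\sum_{i=1}^N\bar\lambda^i_{s_i}(x_{s_i})$ the associated separable approximation of the reward-to-go, and $m_{i,a}$ the associated assignment weights, all as defined in the context. Then the primal-dual heuristic (choose an action $\mathbf a\in\Pi_{[N]}$ minimizing $I((\mathbf x;\mathbf s),\mathbf a)$) is equivalent to the one-step lookahead policy based on $\tilde J$; that is, for every state $(\mathbf x;\mathbf s)\in\mathcal S\times\Pi_{[N]}$, $$\operatorname*{argmin}_{\mathbf a\in\Pi_{[N]}}I((\mathbf x;\mathbf s),\mathbf a)=\operatorname*{argmax}_{\mathbf a\in\Pi_{[N]}}\Big\{R((\mathbf x;\mathbf s),\mathbf a)+\alpha\sum_{\mathbf x'\in\mathcal S}\mathcal P_{\mathbf x\,\mathbf a\,\mathbf x'}\,\tilde J(\mathbf x';\mathbf a)\Big\}=\operatorname*{argmax}_{\mathbf a\in\Pi_{[N]}}\sum_{i=1}^N m_{i,a_i}.$$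
   Context: Notation: $[N]=\{1,\dots,N\}$; $\delta_y(z)=1$ if $y=z$ and $0$ otherwise; $\Pi_{[N]}$ is the set of permutation vectors of $[N]$; $b_i=1$ if $i\le M$ and $b_i=0$ if $i>M$. The problem. There are $N$ sites; site $n$ has a finite state space $S_n$, and $\mathcal S=S_1\times\cdots\times S_N$. There are $N$ agents; agents $1,\dots,M$ are active and agents $M+1,\dots,N$ are passive. At every time each site is occupied by exactly one agent. A state is $(\mathbf x;\mathbf s)\in\mathcal S\times\Pi_{[N]}$ ($x_n$ is the state of site $n$, $s_i$ the site of agent $i$). An action is $\mathbf a\in\Pi_{[N]}$ ($a_i$ is the site to which agent $i$ is sent). For each site $n$, $p^1_n,p^0_n$ are transition probability matrices on $S_n$ and $r^1_n,r^0_n:S_n\to\mathbb R$ are rewards (active and passive respectively); $c_{kl}\in\mathbb R$ are arbitrary switching costs. The immediate reward and the transition probabilities of the site states are $$R((\mathbf x;\mathbf s),\mathbf a)=\sum_{i=1}^N\big(r^{b_i}_{a_i}(x_{a_i})-b_i\,c_{s_ia_i}\big),\qquad \mathcal P_{\mathbf x\,\mathbf a\,\mathbf x'}=\prod_{i=1}^N p^{b_i}_{a_i}(x_{a_i},x'_{a_i}),$$ and the agents' positions become $\mathbf a$. The discount factor is $\alpha\in(0,1)$; $\nu_s$ is a given probability distribution on $S_s$ for each site $s$ (initial site states), and $\mathbf d\in\Pi_{[N]}$ is the initial position vector. The linear program (D), dual to a linear programming relaxation of the problem. Real (sign-unrestricted) variables: $\lambda^i_s(x)$ ($i,s\in[N]$,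 $x\in S_s$), $\mu^i_{s,a}$ ($i,s,a\in[N]$, $s\ne a$), $\kappa_s(x)$ ($s\in[N]$, $x\in S_s$), $\zeta^i_a$ and $\xi^i_s$ ($i,a,s\in[N]$). Minimize $$(1-\alpha)\sum_{i=1}^N\sum_{s=1}^N\sum_{x\in S_s}\nu_s(x)\,\delta_{d_i}(s)\,\lambda^i_s(x)$$ subject to: (D1) for all $i,s,a\in[N]$ with $s\neq a$ and $x\in S_s$: $\ \lambda^i_s(x)+\mu^i_{s,a}+\kappa_s(x)-\sum_{i'\ne i}\zeta^{i'}_a+\sum_{a'\neq a}\zeta^i_{a'}\ge 0$; (D2) for all $i,s,a\in[N]$ with $s\ne a$ and $x\in S_a$: $\ -\alpha\sum_{\tilde x\in S_a}p^{b_i}_a(x,\tilde x)\lambda^i_a(\tilde x)-\mu^i_{s,a}-\kappa_a(x)-\sum_{i'\ne i}\xi^{i'}_s+\sum_{s'\neq s}\xi^i_{s'}\ge r^{b_i}_a(x)-b_i\,c_{sa}$; (D3) for all $i,s\in[N]$ and $x\in S_s$: $\ \lambda^i_s(x)-\alpha\sum_{\tilde x\in S_s}p^{b_i}_s(x,\tilde x)\lambda^i_s(\tilde x)-\sum_{i'\neq i}(\zeta^{i'}_s+\xi^{i'}_s)+\sum_{s'\ne s}(\zeta^i_{s'}+\xi^i_{s'})\ge r^{b_i}_s(x)-b_i\,c_{ss}$. Here $i',a',s'$ range over $[N]$. Reduced costs. At the optimal solution $(\bar\lambda,\bar\mu,\bar\kappa,\bar\zeta,\bar\xi)$, for $s\ne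 a$ let $\bar\gamma^{i,\mathrm{or}}_{s,a}(x)$ ($x\in S_s$) be the left-hand side minus right-hand side of (D1), and $\bar\gamma^{i,\mathrm{de}}_{s,a}(x)$ ($x\in S_a$) the left-hand side minus right-hand side of (D2); let $\bar\gamma^i_{s,s}(x)$ ($x\in S_s$) be the left-hand side minus right-hand side of (D3). Index of undesirability: $$I((\mathbf x;\mathbf s),\mathbf a)=\sum_{i:\,s_i\ne a_i}\big(\bar\gamma^{i,\mathrm{or}}_{s_i,a_i}(x_{s_i})+\bar\gamma^{i,\mathrm{de}}_{s_i,a_i}(x_{a_i})\big)+\sum_{i:\,s_i=a_i}\bar\gamma^i_{s_i,s_i}(x_{s_i}).$$ One-step lookahead policy: in state $(\mathbf x;\mathbf s)$ choose $\mathbf a\in\Pi_{[N]}$ maximizing $R((\mathbf x;\mathbf s),\mathbf a)+\alpha\sum_{\mathbf x'\in\mathcal S}\mathcal P_{\mathbf x\,\mathbf a\,\mathbf x'}\tilde J(\mathbf x';\mathbf a)$. Assignment weights in state $(\mathbf x;\mathbf s)$: $$m_{i,a}=r^{b_i}_a(x_a)-b_i\,c_{s_ia}+\alpha\sum_{x'\in S_a}\bar\lambda^i_a(x')\,p^{b_i}_a(x_a,x'),\qquad i,a\in[N].$$ *)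

theory Defs
  imports Complex_Main "HOL-Library.FuncSet" "HOL-Combinatorics.Permutations"
begin

text \<open>
  Data of a restless bandit problem with switching costs. Sites and agents are numbered from 1
  to \<open>N\<close>; the individual state spaces \<open>S\<^sub>n\<close> are subsets of a common type. The first argument of
  \<open>trans\<close> and \<open>reward\<close> is the mode \<open>b\<close> (1: active, 0: passive), the second one the site.
\<close>

record 'x bandit =
  num_sites :: nat
  num_active :: nat
  site_states :: "nat \<Rightarrow> 'x set"
  trans :: "nat \<Rightarrow> nat \<Rightarrow> 'x \<Rightarrow> 'x \<Rightarrow> real"
  reward :: "nat \<Rightarrow> nat \<Rightarrow> 'x \<Rightarrow> real"
  switch_cost :: "nat \<Rightarrow> nat \<Rightarrow> real"
  discount :: real
  init_dist :: "nat \<Rightarrow> 'x \<Rightarrow> real"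
  init_pos :: "nat \<Rightarrow> nat"

definition sites :: "'x bandit \<Rightarrow> nat set" where
  "sites B = {1..num_sites B}"

text \<open>A permutation vector is represented by the permutation extended by the identity outside
  \<open>{1..N}\<close>, so that equal vectors are equal functions.\<close>

definition perm_vectors :: "'x bandit \<Rightarrow> (nat \<Rightarrow> nat) set" where
  "perm_vectors B = {a. a permutes sites B}"

definition joint_states :: "'x bandit \<Rightarrow> (nat \<Rightarrow> 'x) set" where
  "joint_states B = (\<Pi>\<^sub>E n\<in>sites B. site_states B n)"

definition mode :: "'x bandit \<Rightarrow> nat \<Rightarrow> nat" where
  "mode B i = (if i \<le> num_active B then 1 else 0)"

definition prob_vector_on :: "'x set \<Rightarrow> ('x \<Rightarrow> real) \<Rightarrow> bool" where
  "prob_vector_on A q \<longleftrightarrow> (\<forall>y\<in>A. 0 \<le> q y) \<and> (\<Sum>y\<in>A. q y) = 1"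

definition bandit_problem :: "'x bandit \<Rightarrow> bool" where
  "bandit_problem B \<longleftrightarrow>
     num_active B \<le> num_sites B \<and>
     (\<forall>n\<in>sites B. finite (site_states B n)) \<and>
     (\<forall>b\<in>{0, 1}. \<forall>n\<in>sites B. \<forall>x\<in>site_states B n.
        prob_vector_on (site_states B n) (trans B b n x)) \<and>
     0 < discount B \<and> discount B < 1 \<and>
     (\<forall>n\<in>sites B. prob_vector_on (site_states B n) (init_dist B n)) \<and>
     init_pos B \<in> perm_vectors B"

definition total_reward ::
  "'x bandit \<Rightarrow> (nat \<Rightarrow> 'x) \<Rightarrow> (nat \<Rightarrow> nat) \<Rightarrow> (nat \<Rightarrow> nat) \<Rightarrow> real" where
  "total_reward B x s a =
     (\<Sum>i\<in>sites B. reward B (mode B i) (a i) (x (a i))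
        - real (mode B i) * switch_cost B (s i) (a i))"

definition joint_trans ::
  "'x bandit \<Rightarrow> (nat \<Rightarrow> 'x) \<Rightarrow> (nat \<Rightarrow> nat) \<Rightarrow> (nat \<Rightarrow> 'x) \<Rightarrow> real" where
  "joint_trans B x a x' = (\<Prod>i\<in>sites B. trans B (mode B i) (a i) (x (a i)) (x' (a i)))"

text \<open>
  The dual variables: \<open>dlam v i s x\<close> is \<open>\<lambda>\<^sup>i\<^sub>s(x)\<close>, \<open>dmu v i s a\<close> is \<open>\<mu>\<^sup>i\<^sub>s\<^sub>a\<close>, \<open>dkappa v s x\<close> is
  \<open>\<kappa>\<^sub>s(x)\<close>, \<open>dzeta v i a\<close> is \<open>\<zeta>\<^sup>i\<^sub>a\<close> and \<open>dxi v i s\<close> is \<open>\<xi>\<^sup>i\<^sub>s\<close>. Values at indices outside the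
  ranges of the linear program (including \<open>dmu v i s s\<close>) do not occur in any constraint or in the
  objective.
\<close>

record 'x dual_vars =
  dlam :: "nat \<Rightarrow> nat \<Rightarrow> 'x \<Rightarrow> real"
  dmu :: "nat \<Rightarrow> nat \<Rightarrow> nat \<Rightarrow> real"
  dkappa :: "nat \<Rightarrow> 'x \<Rightarrow> real"
  dzeta :: "nat \<Rightarrow> nat \<Rightarrow> real"
  dxi :: "nat \<Rightarrow> nat \<Rightarrow> real"

definition dual_objective :: "'x bandit \<Rightarrow> 'x dual_vars \<Rightarrow> real" where
  "dual_objective B v =
     (1 - discount B) *
     (\<Sum>i\<in>sites B. \<Sum>s\<in>sites B. \<Sum>x\<in>site_states B s.
        init_dist B s x * (if s = init_pos B i then 1 else 0) * dlam v i s x)"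

text \<open>Left- and right-hand sides of the constraints: \<open>origin\<close> (for \<open>s \<noteq> a\<close>, \<open>x \<in> S\<^sub>s\<close>; its
  right-hand side is 0), \<open>dest\<close> (for \<open>s \<noteq> a\<close>, \<open>x \<in> S\<^sub>a\<close>) and \<open>stay\<close> (for \<open>s = a\<close>, \<open>x \<in> S\<^sub>s\<close>).\<close>

definition origin_lhs :: "'x bandit \<Rightarrow> 'x dual_vars \<Rightarrow> nat \<Rightarrow> nat \<Rightarrow> nat \<Rightarrow> 'x \<Rightarrow> real" where
  "origin_lhs B v i s a x =
     dlam v i s x + dmu v i s a + dkappa v s x
     - (\<Sum>i'\<in>sites B - {i}. dzeta v i' a)
     + (\<Sum>a'\<in>sites B - {a}. dzeta v i a')"

definition dest_lhs :: "'x bandit \<Rightarrow> 'x dual_vars \<Rightarrow> nat \<Rightarrow> nat \<Rightarrow> nat \<Rightarrow> 'x \<Rightarrow> real" where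
  "dest_lhs B v i s a x =
     - discount B * (\<Sum>y\<in>site_states B a. trans B (mode B i) a x y * dlam v i a y)
     - dmu v i s a - dkappa v a x
     - (\<Sum>i'\<in>sites B - {i}. dxi v i' s)
     + (\<Sum>s'\<in>sites B - {s}. dxi v i s')"

definition dest_rhs :: "'x bandit \<Rightarrow> nat \<Rightarrow> nat \<Rightarrow> nat \<Rightarrow> 'x \<Rightarrow> real" where
  "dest_rhs B i s a x =
     reward B (mode B i) a x - real (mode B i) * switch_cost B s a"

definition stay_lhs :: "'x bandit \<Rightarrow> 'x dual_vars \<Rightarrow> nat \<Rightarrow> nat \<Rightarrow> 'x \<Rightarrow> real" where
  "stay_lhs B v i s x =
     dlam v i s x
     - discount B * (\<Sum>y\<in>site_states B s. trans B (mode B i) s x y * dlam v i s y)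
     - (\<Sum>i'\<in>sites B - {i}. dzeta v i' s + dxi v i' s)
     + (\<Sum>s'\<in>sites B - {s}. dzeta v i s' + dxi v i s')"

definition stay_rhs :: "'x bandit \<Rightarrow> nat \<Rightarrow> nat \<Rightarrow> 'x \<Rightarrow> real" where
  "stay_rhs B i s x =
     reward B (mode B i) s x - real (mode B i) * switch_cost B s s"

definition dual_feasible :: "'x bandit \<Rightarrow> 'x dual_vars \<Rightarrow> bool" where
  "dual_feasible B v \<longleftrightarrow>
     (\<forall>i\<in>sites B. \<forall>s\<in>sites B. \<forall>a\<in>sites B. s \<noteq> a \<longrightarrow>
        (\<forall>x\<in>site_states B s. origin_lhs B v i s a x \<ge> 0)) \<and>
     (\<forall>i\<in>sites B. \<forall>s\<in>sites B. \<forall>a\<in>sites B. s \<noteq> a \<longrightarrow>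
        (\<forall>x\<in>site_states B a. dest_lhs B v i s a x \<ge> dest_rhs B i s a x)) \<and>
     (\<forall>i\<in>sites B. \<forall>s\<in>sites B. \<forall>x\<in>site_states B s.
        stay_lhs B v i s x \<ge> stay_rhs B i s x)"

definition dual_optimal :: "'x bandit \<Rightarrow> 'x dual_vars \<Rightarrow> bool" where
  "dual_optimal B v \<longleftrightarrow> is_arg_min (dual_objective B) (dual_feasible B) v"

definition reduced_origin :: "'x bandit \<Rightarrow> 'x dual_vars \<Rightarrow> nat \<Rightarrow> nat \<Rightarrow> nat \<Rightarrow> 'x \<Rightarrow> real" where
  "reduced_origin B v i s a x = origin_lhs B v i s a x - 0"

definition reduced_dest :: "'x bandit \<Rightarrow> 'x dual_vars \<Rightarrow> nat \<Rightarrow> nat \<Rightarrow> nat \<Rightarrow> 'x \<Rightarrow> real" where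
  "reduced_dest B v i s a x = dest_lhs B v i s a x - dest_rhs B i s a x"

definition reduced_stay :: "'x bandit \<Rightarrow> 'x dual_vars \<Rightarrow> nat \<Rightarrow> nat \<Rightarrow> 'x \<Rightarrow> real" where
  "reduced_stay B v i s x = stay_lhs B v i s x - stay_rhs B i s x"

definition undesirability ::
  "'x bandit \<Rightarrow> 'x dual_vars \<Rightarrow> (nat \<Rightarrow> 'x) \<Rightarrow> (nat \<Rightarrow> nat) \<Rightarrow> (nat \<Rightarrow> nat) \<Rightarrow> real" where
  "undesirability B v x s a =
     (\<Sum>i\<in>{i \<in> sites B. s i \<noteq> a i}.
        reduced_origin B v i (s i) (a i) (x (s i)) + reduced_dest B v i (s i) (a i) (x (a i)))
     + (\<Sum>i\<in>{i \<in> sites B. s i = a i}. reduced_stay B v i (s i) (x (s i)))"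

definition approx_reward_to_go ::
  "'x bandit \<Rightarrow> 'x dual_vars \<Rightarrow> (nat \<Rightarrow> 'x) \<Rightarrow> (nat \<Rightarrow> nat) \<Rightarrow> real" where
  "approx_reward_to_go B v x s = (\<Sum>i\<in>sites B. dlam v i (s i) (x (s i)))"

definition lookahead_value ::
  "'x bandit \<Rightarrow> ((nat \<Rightarrow> 'x) \<Rightarrow> (nat \<Rightarrow> nat) \<Rightarrow> real) \<Rightarrow>
   (nat \<Rightarrow> 'x) \<Rightarrow> (nat \<Rightarrow> nat) \<Rightarrow> (nat \<Rightarrow> nat) \<Rightarrow> real" where
  "lookahead_value B J x s a =
     total_reward B x s a
     + discount B * (\<Sum>x'\<in>joint_states B. joint_trans B x a x' * J x' a)"

definition assignment_weight ::
  "'x bandit \<Rightarrow> 'x dual_vars \<Rightarrow> (nat \<Rightarrow> 'x) \<Rightarrow> (nat \<Rightarrow> nat) \<Rightarrow> nat \<Rightarrow> nat \<Rightarrow> real" where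
  "assignment_weight B v x s i a =
     reward B (mode B i) a (x a) - real (mode B i) * switch_cost B (s i) a
     + discount B * (\<Sum>y\<in>site_states B a. dlam v i a y * trans B (mode B i) a (x a) y)"

definition argmin_on :: "'b set \<Rightarrow> ('b \<Rightarrow> real) \<Rightarrow> 'b set" where
  "argmin_on A f = {a. is_arg_min f (\<lambda>a. a \<in> A) a}"

definition argmax_on :: "'b set \<Rightarrow> ('b \<Rightarrow> real) \<Rightarrow> 'b set" where
  "argmax_on A f = {a. is_arg_max f (\<lambda>a. a \<in> A) a}"

end

theory Submission
  imports Defs
begin

text \<open>
  Up to the separable approximation at the current state, which does not depend on the action,
  the index of undesirability is the negative of the assignment value. Indeed, in the reduced costs
  of each agent \<open>\<mu>\<close> cancels, and \<open>\<kappa>\<close>, \<open>\<zeta>\<close>, \<open>\<xi>\<close> enter through differences which sum to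
  zero over the agents, because both the current positions and the action are permutations. The lookahead value equals the
  assignment value, because under the product transition law the expectation of each summand of
  the separable approximation only involves one marginal.
\<close>

text \<open>Absorbing \<open>f\<close> into the factor at \<open>k\<close> turns each summand into a
  product of functions of single coordinates. The sum over \<open>Pi\<^sub>E I S\<close> then
  factorises, and every factor other than the one at \<open>k\<close> is a total mass 1.\<close>

lemma sum_PiE_prod_marginal:
  fixes q :: "'a \<Rightarrow> 'b \<Rightarrow> 'c::comm_semiring_1"
  assumes "finite I" and "\<And>n. n \<in> I \<Longrightarrow> finite (S n)"
    and mass: "\<And>n. n \<in> I \<Longrightarrow> (\<Sum>y\<in>S n. q n y) = 1" and "k \<in> I"
  shows "(\<Sum>z\<in>Pi\<^sub>E I S. (\<Prod>n\<in>I. q n (z n)) * f (z k)) = (\<Sum>y\<in>S k. q k y * f y)"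
proof -
  define w where "w n y = q n y * (if n = k then f y else 1)" for n y
  have "(\<Prod>n\<in>I. q n (z n)) * f (z k) = (\<Prod>n\<in>I. w n (z n))" for z
    using assms(1,4) by (simp add: w_def prod.distrib prod.delta)
  then have "(\<Sum>z\<in>Pi\<^sub>E I S. (\<Prod>n\<in>I. q n (z n)) * f (z k)) = (\<Prod>n\<in>I. \<Sum>y\<in>S n. w n y)"
    using assms(1,2) by (simp add: prod_sum_PiE)
  also have "\<dots> = (\<Prod>n\<in>I. if n = k then \<Sum>y\<in>S k. q k y * f y else 1)"
    by (rule prod.cong) (auto simp: w_def mass)
  also have "\<dots> = (\<Sum>y\<in>S k. q k y * f y)"
    using assms(1,4) by (simp add: prod.delta)
  finally show ?thesis .
qed

lemma sum_diff_permutes_eq_0: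
  fixes h :: "'a \<Rightarrow> 'b::ab_group_add"
  assumes "a permutes A" "s permutes A"
  shows "(\<Sum>i\<in>A. h (s i) - h (a i)) = 0"
  using sum.permute[OF assms(1), of h] sum.permute[OF assms(2), of h]
  by (simp add: sum_subtractf o_def)

lemma finite_sites [simp]: "finite (sites B)"
  by (simp add: sites_def)

lemma lookahead_value_eq_assignment:
  assumes B: "bandit_problem B" and x: "x \<in> joint_states B" and a: "a \<in> perm_vectors B"
  shows "lookahead_value B (approx_reward_to_go B v) x s a
    = (\<Sum>i\<in>sites B. assignment_weight B v x s i (a i))"
proof -
  let ?A = "sites B" and ?S = "site_states B"
  have perm: "a permutes ?A"
    using a by (simp add: perm_vectors_def)
  have a_in: "a i \<in> ?A" if "i \<in> ?A" for i
    using that permutes_in_image[OF perm] by simp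
  \<comment> \<open>Joint transitions are a product over agents, joint states a product over sites.
    Since \<open>inv a n\<close> is the agent sent to \<open>n\<close>, \<open>q n\<close> is the
    law of the next state of site \<open>n\<close>.\<close>
  define q where "q n = trans B (mode B (inv a n)) n (x n)" for n
  have q_a: "q (a i) = trans B (mode B i) (a i) (x (a i))" for i
    by (simp add: q_def permutes_inverses[OF perm])
  have fin: "finite (?S n)" if "n \<in> ?A" for n
    using B that by (simp add: bandit_problem_def)
  \<comment> \<open>\<open>mode\<close> only takes the values 0 and 1, so whichever agent serves
    \<open>n\<close>, \<open>q n\<close> is a row of a stochastic matrix.\<close>
  have mass: "(\<Sum>y\<in>?S n. q n y) = 1" if "n \<in> ?A" for n
    using B x that
    by (auto simp: bandit_problem_def prob_vector_on_def q_def mode_def joint_states_def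
        dest: PiE_mem)
  have joint: "joint_trans B x a z = (\<Prod>n\<in>?A. q n (z n))" for z
    using prod.permute[OF perm, of "\<lambda>n. q n (z n)"] by (simp add: joint_trans_def q_a o_def)
  have "(\<Sum>z\<in>joint_states B. joint_trans B x a z * approx_reward_to_go B v z a)
      = (\<Sum>i\<in>?A. \<Sum>z\<in>Pi\<^sub>E ?A ?S. (\<Prod>n\<in>?A. q n (z n)) * dlam v i (a i) (z (a i)))"
    unfolding approx_reward_to_go_def joint joint_states_def sum_distrib_left by (rule sum.swap)
  also have "\<dots> = (\<Sum>i\<in>?A. \<Sum>y\<in>?S (a i). q (a i) y * dlam v i (a i) y)"
    by (intro sum.cong refl sum_PiE_prod_marginal finite_sites fin mass a_in)
  finally show ?thesis
    by (simp add: lookahead_value_def total_reward_def assignment_weight_def q_a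
        sum.distrib sum_distrib_left mult.commute)
qed

lemma undesirability_eq_assignment:
  assumes s: "s \<in> perm_vectors B" and a: "a \<in> perm_vectors B"
  shows "undesirability B v x s a
    = approx_reward_to_go B v x s - (\<Sum>i\<in>sites B. assignment_weight B v x s i (a i))"
proof -
  let ?A = "sites B"
  have perm: "a permutes ?A" "s permutes ?A"
    using a s by (simp_all add: perm_vectors_def)
  have in_A: "a i \<in> ?A" "s i \<in> ?A" if "i \<in> ?A" for i
    using that permutes_in_image[OF perm(1)] permutes_in_image[OF perm(2)] by simp_all
  \<comment> \<open>Each constraint contains a row sum minus a column sum, both without the same
    diagonal entry; this entry cancels, leaving full row and column totals.\<close>
  define row col where "row z i = (\<Sum>n\<in>?A. z i n)" and "col z n = (\<Sum>i\<in>?A. z i n)"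
    for z :: "nat \<Rightarrow> nat \<Rightarrow> real" and i n
  have offdiag: "(\<Sum>j\<in>?A - {i}. z j n) = col z n - z i n"
      "(\<Sum>m\<in>?A - {n}. z i m) = row z i - z i n"
    if "i \<in> ?A" "n \<in> ?A" for z :: "nat \<Rightarrow> nat \<Rightarrow> real" and i n
    using that by (simp_all add: row_def col_def sum_diff1)
  \<comment> \<open>Row totals and column totals both add up to the sum of all entries, and
    permuting the columns does not change this.\<close>
  have row_col: "(\<Sum>i\<in>?A. row z i - col z (p i)) = 0" if "p permutes ?A" for z p
    using sum.permute[OF that, of "col z"] sum.swap[of z ?A ?A]
    by (simp add: sum_subtractf row_def col_def o_def)
  \<comment> \<open>A common form for the contribution of an agent that moves or stays: if
    \<open>s i = a i\<close>, the \<open>dkappa\<close> difference vanishes.\<close>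
  define g where "g i = dlam v i (s i) (x (s i)) - assignment_weight B v x s i (a i)
    + (dkappa v (s i) (x (s i)) - dkappa v (a i) (x (a i)))
    + (row (dzeta v) i - col (dzeta v) (a i)) + (row (dxi v) i - col (dxi v) (s i))" for i
  have move: "reduced_origin B v i (s i) (a i) (x (s i)) + reduced_dest B v i (s i) (a i) (x (a i))
      = g i" if "i \<in> ?A" for i
    using that in_A[OF that]
    by (simp add: reduced_origin_def reduced_dest_def origin_lhs_def dest_lhs_def dest_rhs_def
        g_def assignment_weight_def offdiag mult.commute)
  have stay: "reduced_stay B v i (a i) (x (a i)) = g i" if "i \<in> ?A" "s i = a i" for i
    using that in_A[OF that(1)]
    by (simp add: reduced_stay_def stay_lhs_def stay_rhs_def g_def assignment_weight_def
        sum.distrib offdiag mult.commute)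
  have "undesirability B v x s a = (\<Sum>i\<in>{i \<in> ?A. s i \<noteq> a i}. g i) + (\<Sum>i\<in>{i \<in> ?A. s i = a i}. g i)"
    unfolding undesirability_def by (intro arg_cong2[where f = "(+)"] sum.cong) (auto simp: move stay)
  also have "\<dots> = (\<Sum>i\<in>?A. g i)"
    by (subst sum.union_disjoint[symmetric]) (auto intro: sum.cong)
  \<comment> \<open>The \<open>dzeta\<close> columns are indexed by \<open>a\<close>, the
    \<open>dxi\<close> columns by \<open>s\<close>, so each permutation is needed once; the
    \<open>dkappa\<close> term uses both.\<close>
  also have "\<dots> = approx_reward_to_go B v x s - (\<Sum>i\<in>?A. assignment_weight B v x s i (a i))"
    unfolding g_def sum.distrib row_col[OF perm(1)] row_col[OF perm(2)]
      sum_diff_permutes_eq_0[OF perm, of "\<lambda>n. dkappa v n (x n)"]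
    by (simp add: approx_reward_to_go_def sum_subtractf)
  finally show ?thesis .
qed

lemma argmax_on_cong:
  assumes "\<And>a. a \<in> A \<Longrightarrow> f a = g a"
  shows "argmax_on A f = argmax_on A g"
  using assms by (auto simp: argmax_on_def is_arg_max_def)

lemma argmin_on_eq_argmax_on:
  fixes f g :: "'b \<Rightarrow> real"
  assumes "\<And>a. a \<in> A \<Longrightarrow> f a = c - g a"
  shows "argmin_on A f = argmax_on A g"
  using assms by (auto simp: argmin_on_def argmax_on_def is_arg_min_def is_arg_max_def)

theorem theorem4p1:
  fixes B :: "'x bandit" and v :: "'x dual_vars"
    and x :: "nat \<Rightarrow> 'x" and s :: "nat \<Rightarrow> nat"
  assumes "bandit_problem B"
    and "dual_optimal B v"
    and "x \<in> joint_states B"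
    and "s \<in> perm_vectors B"
  shows "argmin_on (perm_vectors B) (\<lambda>a. undesirability B v x s a)
           = argmax_on (perm_vectors B)
               (\<lambda>a. lookahead_value B (approx_reward_to_go B v) x s a)
       \<and> argmax_on (perm_vectors B)
             (\<lambda>a. lookahead_value B (approx_reward_to_go B v) x s a)
           = argmax_on (perm_vectors B)
               (\<lambda>a. \<Sum>i\<in>sites B. assignment_weight B v x s i (a i))"
proof -
  have "argmax_on (perm_vectors B) (\<lambda>a. lookahead_value B (approx_reward_to_go B v) x s a)
      = argmax_on (perm_vectors B) (\<lambda>a. \<Sum>i\<in>sites B. assignment_weight B v x s i (a i))"
    using assms(1,3) by (intro argmax_on_cong lookahead_value_eq_assignment)
  moreover have "argmin_on (perm_vectors B) (\<lambda>a. undesirability B v x s a)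
      = argmax_on (perm_vectors B) (\<lambda>a. \<Sum>i\<in>sites B. assignment_weight B v x s i (a i))"
    using assms(4) by (intro argmin_on_eq_argmax_on[where c = "approx_reward_to_go B v x s"]
        undesirability_eq_assignment)
  ultimately show ?thesis
    by simp
qed

end
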